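(* Consider a \(b\log b\)-Bucket Sort algorithm as described in the context, and let \(T_{b\log b}(X)\) be its running time on input \(X\). Let \(X\) consist of \(n\) keys chosen independently and uniformly at random from \([0,1)\), and let \(R_{b\log b}(t) = -\ln \Pr[T_{b\log b}(X) \ge \mathbb{E}[T_{b\log b}(X)] + t]\). Then there exists a constant \(C>0\) such that for every constant \(c > C\), \(R_{b\log b}(cn) = \Theta(n)\) as \(n\to\infty\).
   Context: Bucket Sort on \(n\) keys \(X=\{x_1,\dots,x_n\}\subset[0,1)\): distribute the keys into \(n\) buckets, bucket \(j\in\{0,\dots,n-1\}\) consisting of the keys in \([j/n,(j+1)/n)\); sort the keys of each bucket; then scan the buckets in increasing order and output the keys. Let \(B_j\) be the number of keys in bucket \(j\). A \(b\log b\)-Bucket Sort sorts each bucket of \(b\) keys with a deterministic comparison sorting algorithm taking \(\Theta(b\log b)\) time (e.g. Merge Sort), so that its running time satisfies \(T_{b\log b}(X)=\Theta\big(n+\sum_{j:\,B_j>0} B_j\log B_j\big)\), i.e. there are constants \(0<c_1\le c_2\) with \(c_1(n+\sum_{B_j>0} B_j\log B_j)\le T_{b\log b}(X)\le c_2(n+\sum_{B_j>0} B_j\log B_j)\) for all inputs and all sufficiently large \(n\). The constant \(C\) may depend on \(c_1,c_2\). \(\log\) denotes base-2 logarithm and \(\ln\) the natural logarithm. *)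

theory Defs
  imports "HOL-Probability.Probability" "HOL-Library.Landau_Symbols"
begin

text \<open>An input of \<open>n\<close> keys is a tuple \<open>X\<close> indexed by \<open>{..<n}\<close>, so that key multiplicities are kept.\<close>

definition bucket_count :: "nat \<Rightarrow> (nat \<Rightarrow> real) \<Rightarrow> nat \<Rightarrow> nat" where
  "bucket_count n X j =
     card {i \<in> {..<n}. X i \<in> {real j / real n ..< (real j + 1) / real n}}"

definition blogb_cost :: "nat \<Rightarrow> (nat \<Rightarrow> real) \<Rightarrow> real" where
  "blogb_cost n X = real n +
     (\<Sum>j | j < n \<and> bucket_count n X j > 0.
        real (bucket_count n X j) * log 2 (real (bucket_count n X j)))"

definition random_keys :: "nat \<Rightarrow> (nat \<Rightarrow> real) measure" where
  "random_keys n = Pi\<^sub>M {..<n} (\<lambda>_. uniform_measure lborel {0..<1})"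

text \<open>\<open>T n X\<close> is the running time on the input \<open>X\<close> of \<open>n\<close> keys. The measurability clause only
  makes the probability and the expectation of the running time meaningful; it holds for every
  deterministic comparison-based algorithm, whose running time depends only on the bucket indices
  and the relative order of the keys.\<close>

definition blogb_bucket_sort_time ::
    "real \<Rightarrow> real \<Rightarrow> (nat \<Rightarrow> (nat \<Rightarrow> real) \<Rightarrow> real) \<Rightarrow> bool" where
  "blogb_bucket_sort_time c1 c2 T \<longleftrightarrow>
     (\<forall>n. T n \<in> borel_measurable (random_keys n)) \<and>
     (\<forall>\<^sub>F n in sequentially. \<forall>X \<in> {..<n} \<rightarrow>\<^sub>E {0..<1}.
        c1 * blogb_cost n X \<le> T n X \<and> T n X \<le> c2 * blogb_cost n X)"

text \<open>Since \<open>ln 0 = 0\<close>, a tail event of probability zero gets rate \<open>0\<close> here instead of infinity;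
  both values are incompatible with a rate in \<open>\<Theta>(n)\<close>.\<close>

definition tail_rate :: "(nat \<Rightarrow> (nat \<Rightarrow> real) \<Rightarrow> real) \<Rightarrow> nat \<Rightarrow> real \<Rightarrow> real" where
  "tail_rate T n t =
     - ln (\<P>(X in random_keys n. T n X \<ge> integral\<^sup>L (random_keys n) (T n) + t))"

end

theory Submission
  imports Defs
begin

text \<open>
  Everything rests on the bound \<open>E[\<Prod>\<^sub>j B\<^sub>j!] \<le> 2\<^sup>n\<close>. Throwing one more key into bucket \<open>j\<close>
  multiplies \<open>\<Prod>\<^sub>j B\<^sub>j!\<close> by \<open>B\<^sub>j + 1\<close>; if \<open>i\<close> keys have been thrown, the average of this factor over
  the \<open>n\<close> buckets is \<open>(n + i)/n \<le> 2\<close>. Since \<open>b ln b \<le> b + ln b!\<close>, the cost of an input is at most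
  linear in \<open>n + ln (\<Prod>\<^sub>j B\<^sub>j!)\<close>, so that Markov's inequality bounds the upper tail by \<open>exp (-\<Omega>(n))\<close>,
  and concavity of the logarithm bounds the expected time by \<open>O(n)\<close>. Conversely, with
  probability at least \<open>m\<^sup>-\<^sup>n\<close> all keys fall into the first \<open>\<lfloor>n/m\<rfloor> + 1\<close> buckets, and then convexity of
  \<open>b log b\<close> forces a cost of at least \<open>n log (m/2)\<close>.
\<close>

section \<open>Bucket loads of a set of keys\<close>

text \<open>The key set \<open>I\<close> is separate from the number \<open>n\<close> of buckets, so
  that keys can be added one by one while the buckets stay fixed.\<close>

definition load :: "nat \<Rightarrow> nat set \<Rightarrow> (nat \<Rightarrow> real) \<Rightarrow> nat \<Rightarrow> nat" where
  "load n I X j = card {i \<in> I. X i \<in> {real j / real n ..< (real j + 1) / real n}}"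

lemma bucket_count_eq_load: "bucket_count n X j = load n {..<n} X j"
  by (simp add: bucket_count_def load_def)

text \<open>In terms of floors, disjointness of distinct buckets is immediate.\<close>

lemma mem_bucket_iff_floor:
  assumes "n > 0"
  shows "x \<in> {real j / real n ..< (real j + 1) / real n} \<longleftrightarrow> \<lfloor>x * real n\<rfloor> = int j"
  using assms by (simp add: floor_eq_iff field_simps)

lemma sum_load:
  assumes "n > 0" "finite I"
  shows "(\<Sum>j<k. load n I X j) = card {i \<in> I. \<lfloor>X i * real n\<rfloor> \<in> int ` {..<k}}"
proof -
  have "{i \<in> I. \<lfloor>X i * real n\<rfloor> \<in> int ` {..<k}} = (\<Union>j<k. {i \<in> I. \<lfloor>X i * real n\<rfloor> = int j})"
    by auto
  then show ?thesis
    unfolding load_def mem_bucket_iff_floor[OF assms(1)]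
    using assms(2) by (subst card_UN_disjoint[symmetric]) auto
qed

text \<open>Keys may lie outside the first \<open>k\<close> buckets, hence only an inequality.
  Without a range condition on \<open>X\<close> it can be used at every point of the product
  space.\<close>

lemma sum_load_le:
  assumes "n > 0" "finite I"
  shows "(\<Sum>j<k. load n I X j) \<le> card I"
  unfolding sum_load[OF assms] using assms by (intro card_mono) auto

lemma sum_load_eq:
  assumes "n > 0" "finite I" "\<And>i. i \<in> I \<Longrightarrow> X i \<in> {0..<real k / real n}"
  shows "(\<Sum>j<k. load n I X j) = card I"
proof -
  have "\<lfloor>X i * real n\<rfloor> \<in> int ` {..<k}" if "i \<in> I" for i
  proof -
    have "0 \<le> X i * real n" "X i * real n < real k"
      using assms(1) assms(3)[OF that] by (auto simp: field_simps)
    then have "0 \<le> \<lfloor>X i * real n\<rfloor>" "\<lfloor>X i * real n\<rfloor> < int k"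
      by (auto simp: floor_less_iff)
    then show ?thesis
      by (intro image_eqI[of _ _ "nat \<lfloor>X i * real n\<rfloor>"]) (auto simp: nat_less_iff)
  qed
  then have "{i \<in> I. \<lfloor>X i * real n\<rfloor> \<in> int ` {..<k}} = I" by auto
  then show ?thesis by (simp add: sum_load assms)
qed

lemma load_insert:
  assumes "finite I" "i \<notin> I"
  shows "load n (insert i I) (X(i := y)) j =
    load n I X j + (if y \<in> {real j / real n ..< (real j + 1) / real n} then 1 else 0)"
proof -
  let ?B = "{real j / real n ..< (real j + 1) / real n}"
  have "{l \<in> insert i I. (X(i := y)) l \<in> ?B} =
      {l \<in> I. X l \<in> ?B} \<union> (if y \<in> ?B then {i} else {})"
    using assms(2) by auto
  then show ?thesis
    using assms unfolding load_def by (auto simp: card_insert_if)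
qed

section \<open>Products of factorials of the loads\<close>

definition load_fact_prod :: "nat \<Rightarrow> nat set \<Rightarrow> (nat \<Rightarrow> real) \<Rightarrow> real" where
  "load_fact_prod n I X = (\<Prod>j<n. fact (load n I X j))"

lemma load_fact_prod_pos: "load_fact_prod n I X > 0"
  by (auto simp: load_fact_prod_def intro!: prod_pos)

text \<open>Exactly one indicator is nonzero, because \<open>y\<close> lies in a single bucket. The
  sum over all buckets is kept so that the new key can be integrated out term by term.\<close>

lemma load_fact_prod_insert:
  assumes "finite I" "i \<notin> I" "n > 0" "y \<in> {0..<1}"
  shows "load_fact_prod n (insert i I) (X(i := y)) =
    (\<Sum>j<n. indicator {real j / real n ..< (real j + 1) / real n} y *
       (load_fact_prod n I X * (real (load n I X j) + 1)))"
proof -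
  define k where "k = nat \<lfloor>y * real n\<rfloor>"
  have "y * real n < real n" "0 \<le> y * real n"
    using assms by auto
  then have k: "\<lfloor>y * real n\<rfloor> = int k" "k < n"
    using assms(3) by (auto simp: k_def nat_less_iff floor_less_iff)
  have mem: "y \<in> {real j / real n ..< (real j + 1) / real n} \<longleftrightarrow> j = k" for j
    unfolding mem_bucket_iff_floor[OF assms(3)] k by auto
  have "load_fact_prod n (insert i I) (X(i := y)) =
      (\<Prod>j<n. fact (load n I X j) * (if j = k then real (load n I X j) + 1 else 1))"
    unfolding load_fact_prod_def load_insert[OF assms(1,2)] mem
    by (intro prod.cong) (auto simp: algebra_simps)
  also have "\<dots> = load_fact_prod n I X * (real (load n I X k) + 1)"
    using k by (simp add: prod.distrib load_fact_prod_def prod.delta)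
  also have "\<dots> = (\<Sum>j<n. if j = k then load_fact_prod n I X * (real (load n I X j) + 1) else 0)"
    using k by simp
  also have "\<dots> = (\<Sum>j<n. indicator {real j / real n ..< (real j + 1) / real n} y *
       (load_fact_prod n I X * (real (load n I X j) + 1)))"
    by (intro sum.cong) (use mem in \<open>auto simp: indicator_def\<close>)
  finally show ?thesis .
qed

section \<open>Uniform keys and the mean of the factorial product\<close>

abbreviation unif :: "real measure" where
  "unif \<equiv> uniform_measure lborel {0..<1}"

lemma prob_space_unif: "prob_space unif"
  by (rule prob_space_uniform_measure) auto

interpretation unif: product_prob_space "\<lambda>_. unif" I for I :: "nat set"
  by (intro product_prob_spaceI prob_space_unif)

lemma emeasure_unif_Ico:
  assumes "0 \<le> a" "a \<le> b" "b \<le> 1"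
  shows "emeasure unif {a..<b} = ennreal (b - a)"
proof -
  have "{0..<1} \<inter> {a..<b} = {a..<b}" using assms by auto
  then show ?thesis using assms by (simp add: divide_ennreal_def)
qed

lemma measurable_load [measurable]:
  "(\<lambda>X. load n I X j) \<in> Pi\<^sub>M I (\<lambda>_. unif) \<rightarrow>\<^sub>M count_space UNIV"
  unfolding load_def
proof (rule measurable_card)
  fix i
  let ?M = "Pi\<^sub>M I (\<lambda>_. unif)" and ?B = "{real j / real n..<(real j + 1) / real n}"
  show "{X \<in> space ?M. i \<in> {i \<in> I. X i \<in> ?B}} \<in> sets ?M"
  proof (cases "i \<in> I")
    case True
    then have "(\<lambda>X. X i) -` ?B \<inter> space ?M \<in> sets ?M"
      by (intro measurable_sets[OF measurable_component_singleton]) auto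
    also have "(\<lambda>X. X i) -` ?B \<inter> space ?M = {X \<in> space ?M. i \<in> {i \<in> I. X i \<in> ?B}}"
      using True by auto
    finally show ?thesis .
  qed auto
qed

lemma measurable_load_fact_prod [measurable]:
  "load_fact_prod n I \<in> borel_measurable (Pi\<^sub>M I (\<lambda>_. unif))"
  unfolding load_fact_prod_def by measurable

text \<open>With the keys in \<open>I\<close> fixed, the new key hits each bucket with probability
  \<open>1/n\<close>, so the expected factor is the average of load plus one, where the loads sum to
  at most \<open>card I\<close>.\<close>

lemma nn_integral_load_fact_prod_insert:
  assumes "finite I" "i \<notin> I" "n > 0"
  shows "(\<integral>\<^sup>+y. ennreal (load_fact_prod n (insert i I) (X(i := y))) \<partial>unif)
    \<le> ennreal ((real n + real (card I)) / real n) * ennreal (load_fact_prod n I X)"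
proof -
  define K where "K j = load_fact_prod n I X * (real (load n I X j) + 1)" for j
  have K: "K j \<ge> 0" for j
    using load_fact_prod_pos[of n I X] by (auto simp: K_def)
  let ?B = "\<lambda>j. {real j / real n ..< (real j + 1) / real n}"
  have "(\<integral>\<^sup>+y. ennreal (load_fact_prod n (insert i I) (X(i := y))) \<partial>unif)
      = (\<integral>\<^sup>+y. (\<Sum>j<n. ennreal (K j) * indicator (?B j) y) \<partial>unif)"
  \<comment> \<open>The expansion over buckets is available for \<open>y\<close> in
    \<open>{0..<1}\<close>, which is almost every \<open>y\<close>.\<close>
  proof (intro nn_integral_cong_AE AE_uniform_measureI AE_I2 impI)
    fix y :: real assume "y \<in> {0..<1}"
    then show "ennreal (load_fact_prod n (insert i I) (X(i := y))) =
        (\<Sum>j<n. ennreal (K j) * indicator (?B j) y)"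
      using K unfolding load_fact_prod_insert[OF assms \<open>y \<in> {0..<1}\<close>] K_def[symmetric]
      by (subst sum_ennreal[symmetric])
         (auto intro!: sum.cong mult_nonneg_nonneg simp: indicator_def)
  qed auto
  also have "\<dots> = (\<Sum>j<n. ennreal (K j) * emeasure unif (?B j))"
    by (subst nn_integral_sum)
       (auto intro!: sum.cong nn_integral_cmult_indicator simp del: emeasure_uniform_measure)
  also have "\<dots> = (\<Sum>j<n. ennreal (K j / real n))"
  proof (intro sum.cong refl)
    fix j assume "j \<in> {..<n}"
    then have "emeasure unif (?B j) = ennreal ((real j + 1) / real n - real j / real n)"
      using assms by (intro emeasure_unif_Ico) (auto simp: field_simps)
    also have "(real j + 1) / real n - real j / real n = 1 / real n"
      by (simp add: add_divide_distrib)
    finally show "ennreal (K j) * emeasure unif (?B j) = ennreal (K j / real n)"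
      using K by (simp add: ennreal_mult'[symmetric])
  qed
  also have "\<dots> = ennreal (\<Sum>j<n. K j / real n)"
    using K by (intro sum_ennreal) auto
  also have "(\<Sum>j<n. K j / real n) =
      load_fact_prod n I X * (real (\<Sum>j<n. load n I X j) + real n) / real n"
    by (simp add: K_def sum_divide_distrib[symmetric] sum_distrib_left[symmetric] sum.distrib)
  also have "ennreal \<dots> \<le> ennreal (load_fact_prod n I X * (real (card I) + real n) / real n)"
    using load_fact_prod_pos[of n I X] sum_load_le[OF assms(3,1), of X n]
    by (intro ennreal_leI divide_right_mono mult_left_mono add_right_mono)
       (auto simp del: of_nat_sum)
  also have "\<dots> = ennreal ((real n + real (card I)) / real n) * ennreal (load_fact_prod n I X)"
    using load_fact_prod_pos[of n I X] by (simp add: ennreal_mult'[symmetric] field_simps)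
  finally show ?thesis .
qed

text \<open>Induction on the keys, integrating out the newest key first. Nonnegative integrals are
  used since integrability is only deduced later, from this very bound.\<close>

lemma nn_integral_load_fact_prod_le:
  assumes "finite I" "n > 0"
  shows "(\<integral>\<^sup>+X. ennreal (load_fact_prod n I X) \<partial>Pi\<^sub>M I (\<lambda>_. unif))
    \<le> (\<Prod>i<card I. ennreal ((real n + real i) / real n))"
  using assms(1)
proof (induction I rule: finite_induct)
  case empty
  then show ?case
    by (subst unif.nn_integral_empty) (auto simp: load_fact_prod_def load_def)
next
  case (insert i I)
  have "(\<integral>\<^sup>+X. ennreal (load_fact_prod n (insert i I) X) \<partial>Pi\<^sub>M (insert i I) (\<lambda>_. unif)) =
      (\<integral>\<^sup>+X. (\<integral>\<^sup>+y. ennreal (load_fact_prod n (insert i I) (X(i := y))) \<partial>unif) \<partial>Pi\<^sub>M I (\<lambda>_. unif))"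
    using insert.hyps by (intro unif.product_nn_integral_insert) auto
  also have "\<dots> \<le> (\<integral>\<^sup>+X. ennreal ((real n + real (card I)) / real n) * ennreal (load_fact_prod n I X)
      \<partial>Pi\<^sub>M I (\<lambda>_. unif))"
    using insert.hyps assms(2) by (intro nn_integral_mono nn_integral_load_fact_prod_insert) auto
  also have "\<dots> = ennreal ((real n + real (card I)) / real n) *
      (\<integral>\<^sup>+X. ennreal (load_fact_prod n I X) \<partial>Pi\<^sub>M I (\<lambda>_. unif))"
    by (rule nn_integral_cmult) measurable
  also have "\<dots> \<le> ennreal ((real n + real (card I)) / real n) *
      (\<Prod>i<card I. ennreal ((real n + real i) / real n))"
    by (intro mult_left_mono insert.IH) auto
  also have "\<dots> = (\<Prod>i<card (insert i I). ennreal ((real n + real i) / real n))"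
    using insert.hyps by (simp add: mult.commute)
  finally show ?case .
qed

section \<open>Random inputs\<close>

lemma prob_space_random_keys: "prob_space (random_keys n)"
  unfolding random_keys_def by (intro prob_space_PiM prob_space_unif)

text \<open>The underlying space contains all real keys, so a bound assumed for all inputs with keys
  in \<open>{0..<1}\<close> becomes an almost sure bound.\<close>

lemma AE_random_keys: "AE X in random_keys n. X \<in> {..<n} \<rightarrow>\<^sub>E {0..<1}"
proof -
  have "AE X in random_keys n. X i \<in> {0..<1}" if "i < n" for i
    unfolding random_keys_def using that
    by (intro AE_PiM_component[where P = "\<lambda>x. x \<in> {0..<1}"] prob_space_unif AE_uniform_measureI) auto
  then have "AE X in random_keys n. \<forall>i\<in>{..<n}. X i \<in> {0..<1}"
    by (intro AE_finite_allI) auto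
  moreover have "AE X in random_keys n. X \<in> extensional {..<n}"
    by (intro AE_I2) (auto simp: random_keys_def space_PiM PiE_def)
  ultimately show ?thesis
    by eventually_elim (auto simp: PiE_def)
qed

abbreviation bucket_fact_prod :: "nat \<Rightarrow> (nat \<Rightarrow> real) \<Rightarrow> real" where
  "bucket_fact_prod n \<equiv> load_fact_prod n {..<n}"

lemma
  assumes "n > 0"
  shows integrable_bucket_fact_prod: "integrable (random_keys n) (bucket_fact_prod n)"
    and expectation_bucket_fact_prod_le: "integral\<^sup>L (random_keys n) (bucket_fact_prod n) \<le> 2 ^ n"
proof -
  have "(\<integral>\<^sup>+X. ennreal (bucket_fact_prod n X) \<partial>random_keys n)
      \<le> (\<Prod>i<n. ennreal ((real n + real i) / real n))"
    using nn_integral_load_fact_prod_le[of "{..<n}" n] assms by (simp add: random_keys_def)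
  also have "\<dots> \<le> (\<Prod>i<n. ennreal 2)"
    by (intro prod_mono_ennreal ennreal_leI) (auto simp: field_simps)
  also have "\<dots> = ennreal (2 ^ n)"
    by (simp add: ennreal_power[symmetric])
  finally have le: "(\<integral>\<^sup>+X. ennreal (bucket_fact_prod n X) \<partial>random_keys n) \<le> ennreal (2 ^ n)" .
  have [measurable]: "bucket_fact_prod n \<in> borel_measurable (random_keys n)"
    unfolding random_keys_def by measurable
  have nn: "AE X in random_keys n. bucket_fact_prod n X \<ge> 0"
    by (intro AE_I2 less_imp_le load_fact_prod_pos)
  show int: "integrable (random_keys n) (bucket_fact_prod n)"
    using le nn by (intro integrableI_nonneg) (auto simp: top_unique intro: le_less_trans)
  show "integral\<^sup>L (random_keys n) (bucket_fact_prod n) \<le> 2 ^ n"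
    using le nn_integral_eq_integral[OF int nn] by (simp add: ennreal_le_iff)
qed

section \<open>Deterministic bounds on the cost of an input\<close>

text \<open>The quotient \<open>b^b / b!\<close> is one term of the exponential series of
  \<open>b\<close>, hence at most \<open>exp b\<close>.\<close>

lemma mult_ln_le_ln_fact: "real b * ln (real b) \<le> real b + ln (fact b)"
proof (cases "b = 0")
  case False
  have "real b ^ b / fact b \<le> (\<Sum>k. real b ^ k /\<^sub>R fact k)"
    using sum_le_suminf[OF sums_summable[OF exp_converges[of "real b"]], of "{b}"]
    by (simp add: divide_inverse mult.commute)
  also have "\<dots> = exp (real b)"
    using exp_converges[of "real b"] by (simp add: sums_iff)
  finally have "ln (real b ^ b / fact b) \<le> ln (exp (real b))"
    using False by (subst ln_le_cancel_iff) auto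
  then show ?thesis
    using False by (simp add: ln_div ln_realpow)
qed auto

text \<open>Empty buckets may be included, since their summand is \<open>0\<close>.\<close>

lemma blogb_cost_eq:
  "blogb_cost n X = real n + (\<Sum>j<n. real (load n {..<n} X j) * ln (real (load n {..<n} X j))) / ln 2"
proof -
  have "(\<Sum>j | j < n \<and> load n {..<n} X j > 0.
        real (load n {..<n} X j) * log 2 (real (load n {..<n} X j))) =
      (\<Sum>j<n. real (load n {..<n} X j) * log 2 (real (load n {..<n} X j)))"
    by (intro sum.mono_neutral_left) auto
  then show ?thesis
    by (simp add: blogb_cost_def bucket_count_eq_load log_def sum_divide_distrib)
qed

lemma blogb_cost_ge: "blogb_cost n X \<ge> real n"
proof -
  have "real b * ln (real b) \<ge> 0" for b :: nat
    by (cases "b = 0") auto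
  then show ?thesis
    unfolding blogb_cost_eq by (simp add: sum_nonneg)
qed

lemma blogb_cost_le_ln_bucket_fact_prod:
  assumes "n > 0"
  shows "blogb_cost n X \<le> real n + (real n + ln (bucket_fact_prod n X)) / ln 2"
proof -
  have "(\<Sum>j<n. real (load n {..<n} X j) * ln (real (load n {..<n} X j)))
      \<le> (\<Sum>j<n. real (load n {..<n} X j) + ln (fact (load n {..<n} X j)))"
    by (intro sum_mono mult_ln_le_ln_fact)
  also have "\<dots> = real (\<Sum>j<n. load n {..<n} X j) + ln (bucket_fact_prod n X)"
    by (simp add: sum.distrib load_fact_prod_def ln_prod)
  also have "\<dots> \<le> real n + ln (bucket_fact_prod n X)"
    using sum_load_le[OF assms, of "{..<n}" X n] by (simp del: of_nat_sum)
  finally show ?thesis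
    unfolding blogb_cost_eq by (simp add: divide_right_mono)
qed

text \<open>Jensen's inequality, by the tangent to \<open>b ln b\<close> at the average load \<open>n/k\<close> of the first \<open>k\<close> buckets.\<close>

lemma blogb_cost_concentrated_ge:
  assumes "n > 0" "k > 0" "k \<le> n" "\<And>i. i < n \<Longrightarrow> X i \<in> {0..<real k / real n}"
  shows "blogb_cost n X \<ge> real n * log 2 (real n / real k)"
proof -
  define q where "q = real n / real k"
  have q: "q > 0" using assms by (simp add: q_def)
  have tangent: "real b * ln (real b) \<ge> real b * ln q + (real b - q)" for b :: nat
  proof (cases "b = 0")
    case False
    \<comment> \<open>The bound \<open>ln x \<le> x - 1\<close> at \<open>x = q / b\<close>,
      multiplied by \<open>b\<close>, is the tangent inequality.\<close>
    have "ln (q / real b) \<le> q / real b - 1"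
      using q False by (intro ln_le_minus_one) auto
    then have "real b * (ln q - ln (real b)) \<le> real b * (q / real b - 1)"
      using q False by (intro mult_left_mono) (auto simp: ln_div)
    then show ?thesis using False by (simp add: algebra_simps)
  qed (use q in auto)
  have total: "real (\<Sum>j<k. load n {..<n} X j) = real n"
    using sum_load_eq[OF assms(1), of "{..<n}" X k] assms(4) by simp
  \<comment> \<open>The linear correction vanishes in total: the loads sum to \<open>n\<close>, and
    \<open>k * q = n\<close>.\<close>
  have "real n * ln q = real (\<Sum>j<k. load n {..<n} X j) * ln q
      + (real (\<Sum>j<k. load n {..<n} X j) - real k * q)"
    unfolding total using assms by (simp add: q_def)
  also have "\<dots> = (\<Sum>j<k. real (load n {..<n} X j) * ln q + (real (load n {..<n} X j) - q))"
    by (simp add: sum.distrib sum_subtractf sum_distrib_right)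
  also have "\<dots> \<le> (\<Sum>j<k. real (load n {..<n} X j) * ln (real (load n {..<n} X j)))"
    by (intro sum_mono tangent)
  also have "\<dots> \<le> (\<Sum>j<n. real (load n {..<n} X j) * ln (real (load n {..<n} X j)))"
  proof (intro sum_mono2)
    fix j
    show "0 \<le> real (load n {..<n} X j) * ln (real (load n {..<n} X j))"
      by (cases "load n {..<n} X j = 0") auto
  qed (use assms in auto)
  finally have "real n * ln q / ln 2
      \<le> (\<Sum>j<n. real (load n {..<n} X j) * ln (real (load n {..<n} X j))) / ln 2"
    by (simp add: divide_right_mono)
  then show ?thesis
    unfolding blogb_cost_eq log_def q_def by simp
qed

section \<open>Probability and mean estimates\<close>

lemma prob_all_keys_below:
  assumes "0 \<le> a" "a \<le> 1"
  shows "measure (random_keys n) ({..<n} \<rightarrow>\<^sub>E {0..<a}) = a ^ n"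
proof -
  have "emeasure (random_keys n) ({..<n} \<rightarrow>\<^sub>E {0..<a}) = (\<Prod>i<n. emeasure unif {0..<a})"
    unfolding random_keys_def by (intro unif.emeasure_PiM) auto
  also have "\<dots> = ennreal (a ^ n)"
    using assms emeasure_unif_Ico[of 0 a] by (simp add: ennreal_power)
  finally show ?thesis
    using assms by (simp add: measure_def)
qed

text \<open>Markov's inequality for \<open>bucket_fact_prod\<close>. In the exponent, one
  \<open>ln 2\<close> comes from the summand \<open>n\<close> of the cost, the other from the mean
  bound \<open>2 ^ n\<close>, and the \<open>1\<close> from the error \<open>b\<close> in
  \<open>mult_ln_le_ln_fact\<close>.\<close>

lemma prob_blogb_cost_ge_le:
  assumes "n > 0" "AE X in random_keys n. X \<in> E \<longrightarrow> s * real n \<le> blogb_cost n X"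
  shows "measure (random_keys n) E \<le> exp (- ((s * ln 2 - 2 * ln 2 - 1) * real n))"
proof -
  interpret prob_space "random_keys n" by (rule prob_space_random_keys)
  \<comment> \<open>The threshold comes from solving
    \<open>blogb_cost_le_ln_bucket_fact_prod\<close> for the product when the cost is at least
    \<open>s * n\<close>.\<close>
  define a where "a = exp ((s - 1) * real n * ln 2 - real n)"
  have [measurable]: "bucket_fact_prod n \<in> borel_measurable (random_keys n)"
    unfolding random_keys_def by measurable
  have "AE X in random_keys n. X \<in> E \<longrightarrow> X \<in> {X \<in> space (random_keys n). a \<le> bucket_fact_prod n X}"
    using assms(2) AE_space
  proof eventually_elim
    case (elim X)
    have "a \<le> bucket_fact_prod n X" if "X \<in> E"
    proof -
      have "s * real n \<le> real n + (real n + ln (bucket_fact_prod n X)) / ln 2"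
        using elim that blogb_cost_le_ln_bucket_fact_prod[OF assms(1), of X] by linarith
      then have "(s - 1) * real n * ln 2 \<le> real n + ln (bucket_fact_prod n X)"
        by (simp add: field_simps)
      then show ?thesis
        unfolding a_def using load_fact_prod_pos[of n "{..<n}" X] by (subst ln_ge_iff[symmetric]) auto
    qed
    then show ?case using elim by auto
  qed
  then have "prob E \<le> prob {X \<in> space (random_keys n). a \<le> bucket_fact_prod n X}"
    by (intro finite_measure_mono_AE) auto
  also have "\<dots> \<le> expectation (bucket_fact_prod n) / a"
    using integrable_bucket_fact_prod[OF assms(1)] less_imp_le[OF load_fact_prod_pos]
    by (intro integral_Markov_inequality_measure[where A = "{}"]) (auto simp: a_def)
  also have "\<dots> \<le> 2 ^ n / a"
    using expectation_bucket_fact_prod_le[OF assms(1)]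
    by (intro divide_right_mono) (auto simp: a_def)
  also have "2 ^ n = exp (real n * ln 2)"
    by (simp add: exp_of_nat_mult)
  also have "exp (real n * ln 2) / a = exp (- ((s * ln 2 - 2 * ln 2 - 1) * real n))"
    unfolding a_def by (simp add: exp_diff[symmetric] algebra_simps)
  finally show ?thesis .
qed

lemma integral_le_blogb_cost:
  assumes "n > 0" "c \<ge> 0" "AE X in random_keys n. f X \<le> c * blogb_cost n X"
  shows "integral\<^sup>L (random_keys n) f \<le> c * (2 + 1 / ln 2) * real n"
proof (cases "integrable (random_keys n) f")
  case True
  interpret prob_space "random_keys n" by (rule prob_space_random_keys)
  \<comment> \<open>Here \<open>ln\<close> is replaced by its tangent at \<open>2 ^ n\<close>. The
    majorant is affine in \<open>bucket_fact_prod\<close>, so its mean follows by linearity, and the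
    correction term has mean at most \<open>0\<close>.\<close>
  define g where "g X = c * (real n + (real n + (real n * ln 2 + (bucket_fact_prod n X / 2 ^ n - 1))) / ln 2)"
    for X
  note int = integrable_bucket_fact_prod[OF assms(1)]
  have "expectation f \<le> expectation g"
  proof (intro integral_mono_AE True)
    show "integrable (random_keys n) g"
      unfolding g_def using int by auto
    show "AE X in random_keys n. f X \<le> g X"
      using assms(3)
    proof eventually_elim
      case (elim X)
      have "ln (bucket_fact_prod n X / 2 ^ n) \<le> bucket_fact_prod n X / 2 ^ n - 1"
        using load_fact_prod_pos by (intro ln_le_minus_one) auto
      then have "ln (bucket_fact_prod n X) \<le> real n * ln 2 + (bucket_fact_prod n X / 2 ^ n - 1)"
        using load_fact_prod_pos[of n "{..<n}" X] by (simp add: ln_div ln_realpow)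
      then have "(real n + ln (bucket_fact_prod n X)) / ln 2
          \<le> (real n + (real n * ln 2 + (bucket_fact_prod n X / 2 ^ n - 1))) / ln 2"
        by (intro divide_right_mono) auto
      with blogb_cost_le_ln_bucket_fact_prod[OF assms(1), of X]
      have "blogb_cost n X
          \<le> real n + (real n + (real n * ln 2 + (bucket_fact_prod n X / 2 ^ n - 1))) / ln 2"
        by linarith
      then have "c * blogb_cost n X \<le> g X"
        unfolding g_def using assms(2) by (intro mult_left_mono)
      with elim show ?case by linarith
    qed
  qed
  also have "\<dots> = c * (real n + (real n + (real n * ln 2 +
      (expectation (bucket_fact_prod n) / 2 ^ n - 1))) / ln 2)"
    unfolding g_def using int by (simp add: prob_space)
  also have "\<dots> \<le> c * (real n + (real n + (real n * ln 2 + (2 ^ n / 2 ^ n - 1))) / ln 2)"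
    using expectation_bucket_fact_prod_le[OF assms(1)] assms(2)
    by (intro mult_left_mono add_left_mono divide_right_mono diff_right_mono) auto
  also have "\<dots> = c * (2 + 1 / ln 2) * real n"
    by (simp add: field_simps)
  finally show ?thesis .
next
  \<comment> \<open>The integral of a non-integrable function is \<open>0\<close> by convention, and
    the bound is nonnegative.\<close>
  case False
  then show ?thesis
    using assms(2) by (simp add: not_integrable_integral_eq)
qed

section \<open>Linear rate of the upper tail\<close>

theorem theorem2:
  fixes c1 c2 :: real
  assumes "0 < c1" and "c1 \<le> c2"
  shows "\<exists>C>0. \<forall>T. blogb_bucket_sort_time c1 c2 T \<longrightarrow>
           (\<forall>c>C. (\<lambda>n. tail_rate T n (c * real n)) \<in> \<Theta>(\<lambda>n. real n))"
proof (intro exI[of _ "c2 * (2 + 1 / ln 2)"] conjI allI impI)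
  \<comment> \<open>The mean time is at most \<open>c2 * \<kappa> * n\<close>; the same
    \<open>\<kappa>\<close> is the value of \<open>s\<close> at which the exponent in
    \<open>prob_blogb_cost_ge_le\<close> vanishes.\<close>
  define \<kappa> :: real where "\<kappa> = 2 + 1 / ln 2"
  have \<kappa>: "\<kappa> > 0" by (simp add: \<kappa>_def add_pos_pos)
  have c2: "c2 > 0" using assms by simp
  show "c2 * (2 + 1 / ln 2) > 0" using \<kappa> c2 by (simp add: \<kappa>_def)
  fix T c
  assume T: "blogb_bucket_sort_time c1 c2 T" and "c > c2 * (2 + 1 / ln 2)"
  then have c: "c > c2 * \<kappa>" by (simp add: \<kappa>_def)
  define P where "P n = measure (random_keys n)
      {X \<in> space (random_keys n). integral\<^sup>L (random_keys n) (T n) + c * real n \<le> T n X}" for n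
  have rate: "tail_rate T n (c * real n) = - ln (P n)" for n
    by (simp add: tail_rate_def P_def)
  have meas [measurable]: "T n \<in> borel_measurable (random_keys n)" for n
    using T by (simp add: blogb_bucket_sort_time_def)
  have bounds: "\<forall>\<^sub>F n in sequentially. \<forall>X \<in> {..<n} \<rightarrow>\<^sub>E {0..<1}.
        c1 * blogb_cost n X \<le> T n X \<and> T n X \<le> c2 * blogb_cost n X"
    using T by (simp add: blogb_bucket_sort_time_def)

  \<comment> \<open>This is the Markov exponent for \<open>s = c / c2\<close>; it equals
    \<open>(c / c2 - \<kappa>) * ln 2\<close>.\<close>
  define K1 where "K1 = c / c2 * ln 2 - 2 * ln 2 - 1"
  have "\<kappa> < c / c2" using c c2 by (simp add: field_simps)
  then have "\<kappa> * ln 2 < c / c2 * ln 2" by (intro mult_strict_right_mono) auto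
  then have K1: "K1 > 0" by (simp add: K1_def \<kappa>_def algebra_simps)
  \<comment> \<open>A cost of \<open>D * n\<close> forces a time of at least
    \<open>c2 * \<kappa> * n + c * n\<close>, which is enough to exceed the mean by
    \<open>c * n\<close>.\<close>
  define D where "D = (c2 * \<kappa> + c) / c1"
  \<comment> \<open>The factor \<open>2\<close> pays for rounding: the \<open>k\<close> chosen below
    satisfies only \<open>k * m \<le> 2 * n\<close>.\<close>
  obtain m0 :: nat where m0: "2 * 2 powr D \<le> real m0" using real_arch_simple by blast
  define m where "m = max 2 m0"
  have m: "m \<ge> 2" "2 powr D \<le> real m / 2" using m0 by (auto simp: m_def)

  show "(\<lambda>n. tail_rate T n (c * real n)) \<in> \<Theta>(\<lambda>n. real n)"
  proof (rule bigthetaI'[of K1 "ln (real m)"])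
    show "K1 > 0" by fact
    show "ln (real m) > 0" using m by simp
    show "\<forall>\<^sub>F n in sequentially. K1 * norm (real n) \<le> norm (tail_rate T n (c * real n)) \<and>
        norm (tail_rate T n (c * real n)) \<le> ln (real m) * norm (real n)"
      using bounds eventually_ge_at_top[of m]
    proof eventually_elim
      case (elim n)
      interpret prob_space "random_keys n" by (rule prob_space_random_keys)
      have n: "n > 0" "n \<ge> m" using elim m by auto
      have AE_bounds: "AE X in random_keys n. c1 * blogb_cost n X \<le> T n X \<and> T n X \<le> c2 * blogb_cost n X"
        using AE_random_keys[of n] by eventually_elim (use elim in auto)

      \<comment> \<open>As the mean is nonnegative, the tail event forces
        \<open>T n X \<ge> c * n\<close>, and therefore a cost of at least
        \<open>(c / c2) * n\<close>.\<close>
      have "AE X in random_keys n. 0 \<le> T n X"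
        using AE_bounds
      proof eventually_elim
        case (elim X)
        have "0 \<le> c1 * blogb_cost n X"
          using assms blogb_cost_ge[of n X] by simp
        with elim show ?case by linarith
      qed
      then have mean_nonneg: "0 \<le> expectation (T n)" by (rule integral_nonneg_AE)
      have "AE X in random_keys n. X \<in> {X \<in> space (random_keys n). expectation (T n) + c * real n \<le> T n X}
          \<longrightarrow> c / c2 * real n \<le> blogb_cost n X"
        using AE_bounds
      proof eventually_elim
        case (elim X)
        show ?case
        proof
          assume "X \<in> {X \<in> space (random_keys n). expectation (T n) + c * real n \<le> T n X}"
          then have "c * real n \<le> c2 * blogb_cost n X"
            using elim mean_nonneg by auto
          then show "c / c2 * real n \<le> blogb_cost n X"
            using c2 by (simp add: field_simps)
        qed
      qed
      from prob_blogb_cost_ge_le[OF n(1) this]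
      have upper: "P n \<le> exp (- (K1 * real n))"
        by (simp add: P_def K1_def)

      have mean_le: "expectation (T n) \<le> c2 * \<kappa> * real n"
        unfolding \<kappa>_def using c2 AE_bounds by (intro integral_le_blogb_cost n(1)) auto
      \<comment> \<open>Adding one to the quotient makes \<open>k / n\<close> at least
        \<open>1 / m\<close>; the condition \<open>n \<ge> m\<close> keeps \<open>k * m\<close>
        below or equal to \<open>2 * n\<close>.\<close>
      define k where "k = n div m + 1"
      have "(n div m) * m + m \<le> n + n"
        using n by (intro add_mono div_times_less_eq_dividend)
      then have km: "k * m \<le> 2 * n" unfolding k_def by simp
      have "k * 2 \<le> k * m" using m by simp
      then have kn: "k \<le> n" "k > 0" using km by (auto simp: k_def)
      have "n < k * m" using m by (simp add: k_def dividend_less_div_times)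
      then have "real n < real k * real m" by (simp flip: of_nat_mult)
      then have km': "1 / real m \<le> real k / real n"
        using n m by (simp add: field_simps)
      \<comment> \<open>Crowding all keys into the first \<open>k\<close> buckets costs at least
        \<open>n * log 2 (n / k)\<close>, hence at least \<open>D * n\<close>.\<close>
      have "{..<n} \<rightarrow>\<^sub>E {0..<real k / real n}
          \<subseteq> {X \<in> space (random_keys n). expectation (T n) + c * real n \<le> T n X}"
      proof
        fix X assume X: "X \<in> {..<n} \<rightarrow>\<^sub>E {0..<real k / real n}"
        have "real k / real n \<le> 1" using kn by simp
        then have "X \<in> {..<n} \<rightarrow>\<^sub>E {0..<1}"
          by (intro subsetD[OF PiE_mono X]) auto
        then have TX: "c1 * blogb_cost n X \<le> T n X" using elim by auto
        have "real k * real m \<le> 2 * real n"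
          using km by (metis of_nat_le_iff of_nat_mult of_nat_numeral)
        then have "real m / 2 \<le> real n / real k"
          using kn by (simp add: field_simps)
        with m have "2 powr D \<le> real n / real k" by linarith
        then have "D \<le> log 2 (real n / real k)"
          using n kn by (simp add: le_log_iff)
        then have "real n * D \<le> real n * log 2 (real n / real k)"
          by (intro mult_left_mono) auto
        also have "\<dots> \<le> blogb_cost n X"
          by (intro blogb_cost_concentrated_ge n(1) kn PiE_mem[OF X]) simp
        finally have "c1 * (real n * D) \<le> c1 * blogb_cost n X"
          using assms by (intro mult_left_mono) auto
        moreover have "c1 * (real n * D) = c2 * \<kappa> * real n + c * real n"
          using assms by (simp add: D_def field_simps)
        ultimately have "expectation (T n) + c * real n \<le> T n X"
          using mean_le TX by linarith
        moreover have "X \<in> space (random_keys n)"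
          unfolding random_keys_def space_PiM by (intro subsetD[OF PiE_mono X]) auto
        ultimately show "X \<in> {X \<in> space (random_keys n). expectation (T n) + c * real n \<le> T n X}"
          by simp
      qed
      then have "prob ({..<n} \<rightarrow>\<^sub>E {0..<real k / real n}) \<le> P n"
        unfolding P_def by (intro finite_measure_mono) auto
      then have "(real k / real n) ^ n \<le> P n"
        using kn by (subst (asm) prob_all_keys_below) auto
      moreover have "(1 / real m) ^ n \<le> (real k / real n) ^ n"
        using km' by (intro power_mono) auto
      ultimately have lower: "(1 / real m) ^ n \<le> P n" by linarith
      moreover have "(1 / real m) ^ n > 0" using m by simp
      \<comment> \<open>Positivity rules out the default value \<open>ln 0 = 0\<close> and allows
        logarithms to be compared.\<close>
      ultimately have pos: "P n > 0" by linarith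
      have "ln ((1 / real m) ^ n) \<le> ln (P n)"
        using lower m pos by (subst ln_le_cancel_iff) auto
      then have "- ln (P n) \<le> ln (real m) * real n"
        using m by (simp add: ln_realpow ln_div mult.commute)
      moreover have "K1 * real n \<le> - ln (P n)"
        using ln_mono[OF upper pos] by simp
      \<comment> \<open>The rate is thereby nonnegative, so the norms can be removed.\<close>
      moreover have "K1 * real n \<ge> 0" using K1 by simp
      ultimately show ?case
        unfolding rate by simp
    qed
  qed
qed

end
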